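(* Every thick graph satisfies Sidorenko's conjecture: if $H$ is thick then $t(H,G)\ge t(e,G)^{|E(H)|}$ for every finite graph $G$.
   Context: $t(H,G)$ is the probability that a uniformly random map $V(H)\to V(G)$ maps every edge to an edge; $e$ is the one-edge graph. $b$-hypergraphs and reflection complexes: a $b$-hypergraph is $M=(V,E,B)$ with $V$ finite, $E\subseteq 2^V$, $B\subseteq 2^V\times 2^V$ symmetric; the sub-$b$-hypergraph on $W\subseteq V$ is $(W,\{L\in E:L\subseteq W\},B\cap(2^W\times2^W))$. For $L\in E$, $X\subseteq L$, let $N$ be the sub-$b$-hypergraph on $L$; $r_{L,X}(M)$ has vertex set $V'$ = disjoint union of $V$ and $L$ with the two copies of each $x\in X$ identified (natural injections $\tau_1:V\to V'$, $\tau_2:L\to V'$); its edges are $\tau_1(K)$ ($K\in E$), $\tau_2(K)$ ($K\in E$, $K\subseteq L$), and $\tau_1(K_1)\cup\tau_2(K_2)$ for all $K_1\in E$, $K_2\in E$ with $K_2\subseteq L$ and $X\subseteq K_1$, $X\subseteq K_2$; its relation consists of the $\tau_1$-images of pairs in $B$, the $\tau_2$-images of pairs in $B\cap(2^L\times 2^L)$, and the pairs $(\tau_1(K_1),\tau_2(K_2))$ (and reverses) for such $K_1,K_2$. A reflection complex is a $b$-hypergraph obtained from $(\{1,2\},\{\{1,2\}\},\emptyset)$ by finitely many operations $r_{L,X}$ ($L$ an edge of the current $b$-hypergraph, $X\subseteq L$). The frame $\mathcal{F}(M)$ is the graph on $V$ whose edges are the $2$-element members of $E$. Thickness: in $\mathbb{R}^{2^V}$,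 $1_S$ is the indicator of the single subset $S$; $t_{A,B}=1_{A\cup B}-1_A-1_B+1_{A\cap B}$; $W_B=\mathrm{span}\{t_{A,B}:(A,B)\in B\}$; $Q_V=\mathbb{R}1_\emptyset+\{$nonnegative combinations of all $t_{A,B}$ and all $1_A$, $A,B\subseteq V\}$. For a graph $H$ on $V$ and $X\subseteq V$, $h_H(X)=-1_X+\sum_{e\in E(F)}1_e-\sum_{v\in X}(\deg_F(v)-1)1_{\{v\}}$, where $F$ is the subgraph of $H$ spanned by $X$. A $b$-hypergraph $M=(V,E,B)$ with $H=\mathcal{F}(M)$ is thick if $h_H(V)\in W_B+Q_V$. A thick graph is the frame of a thick reflection complex. *)

theory Defs
  imports "HOL-Probability.Probability"
begin

section \<open>Graphs and homomorphism densities\<close>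

record 'a graph =
  gverts :: "'a set"
  gedges :: "'a set set"

definition finite_graph :: "'a graph \<Rightarrow> bool" where
  "finite_graph G \<longleftrightarrow> finite (gverts G) \<and> (\<forall>e\<in>gedges G. e \<subseteq> gverts G \<and> card e = 2)"

definition edge_graph :: "nat graph" where
  "edge_graph = \<lparr>gverts = {1, 2}, gedges = {{1, 2}}\<rparr>"

text \<open>Meaningful only when \<open>gverts H\<close> is finite and \<open>gverts G\<close> is finite and nonempty, so that
  the uniform distribution on the maps from \<open>gverts H\<close> to \<open>gverts G\<close> exists. As \<open>G\<close> has no loops,
  \<open>f ` e \<in> gedges G\<close> forces the endpoints of \<open>e\<close> to have distinct, adjacent images.\<close>

definition hom_density :: "'a graph \<Rightarrow> 'b graph \<Rightarrow> real" where
  "hom_density H G = measure_pmf.prob (pmf_of_set (gverts H \<rightarrow>\<^sub>E gverts G))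
     {f. \<forall>e\<in>gedges H. f ` e \<in> gedges G}"


section \<open>Reflection complexes\<close>

record 'a bhyp =
  verts :: "'a set"
  edges :: "'a set set"
  brel :: "('a set \<times> 'a set) set"

definition b_hypergraph :: "'a bhyp \<Rightarrow> bool" where
  "b_hypergraph M \<longleftrightarrow> finite (verts M) \<and> edges M \<subseteq> Pow (verts M) \<and>
     brel M \<subseteq> Pow (verts M) \<times> Pow (verts M) \<and> sym (brel M)"

definition sub_bhyp :: "'a bhyp \<Rightarrow> 'a set \<Rightarrow> 'a bhyp" where
  "sub_bhyp M W = \<lparr>verts = W, edges = {L \<in> edges M. L \<subseteq> W},
     brel = brel M \<inter> (Pow W \<times> Pow W)\<rparr>"

text \<open>The disjoint union of \<open>V\<close> and \<open>L\<close> with the two copies of \<open>X\<close> identified is determined only up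
  to bijection; it is any \<open>\<tau>\<^sub>1 ` V \<union> \<tau>\<^sub>2 ` L\<close> for the injections described here.\<close>

definition gluing_maps :: "'a set \<Rightarrow> 'a set \<Rightarrow> 'a set \<Rightarrow> ('a \<Rightarrow> 'b) \<Rightarrow> ('a \<Rightarrow> 'b) \<Rightarrow> bool" where
  "gluing_maps V L X \<tau>\<^sub>1 \<tau>\<^sub>2 \<longleftrightarrow> inj_on \<tau>\<^sub>1 V \<and> inj_on \<tau>\<^sub>2 L \<and>
     (\<forall>x\<in>X. \<tau>\<^sub>1 x = \<tau>\<^sub>2 x) \<and> \<tau>\<^sub>1 ` V \<inter> \<tau>\<^sub>2 ` L = \<tau>\<^sub>1 ` X"

definition reflected_pairs :: "'a bhyp \<Rightarrow> 'a set \<Rightarrow> 'a set \<Rightarrow> ('a set \<times> 'a set) set" where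
  "reflected_pairs M L X =
     {(K\<^sub>1, K\<^sub>2). K\<^sub>1 \<in> edges M \<and> K\<^sub>2 \<in> edges (sub_bhyp M L) \<and> X \<subseteq> K\<^sub>1 \<and> X \<subseteq> K\<^sub>2}"

definition reflect ::
    "'a bhyp \<Rightarrow> 'a set \<Rightarrow> 'a set \<Rightarrow> ('a \<Rightarrow> 'b) \<Rightarrow> ('a \<Rightarrow> 'b) \<Rightarrow> 'b bhyp" where
  "reflect M L X \<tau>\<^sub>1 \<tau>\<^sub>2 = (let N = sub_bhyp M L; P = reflected_pairs M L X in
     \<lparr>verts = \<tau>\<^sub>1 ` verts M \<union> \<tau>\<^sub>2 ` verts N,
      edges = {\<tau>\<^sub>1 ` K |K. K \<in> edges M} \<union> {\<tau>\<^sub>2 ` K |K. K \<in> edges N}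
        \<union> {\<tau>\<^sub>1 ` K\<^sub>1 \<union> \<tau>\<^sub>2 ` K\<^sub>2 |K\<^sub>1 K\<^sub>2. (K\<^sub>1, K\<^sub>2) \<in> P},
      brel = {(\<tau>\<^sub>1 ` A, \<tau>\<^sub>1 ` B) |A B. (A, B) \<in> brel M}
        \<union> {(\<tau>\<^sub>2 ` A, \<tau>\<^sub>2 ` B) |A B. (A, B) \<in> brel N}
        \<union> {(\<tau>\<^sub>1 ` K\<^sub>1, \<tau>\<^sub>2 ` K\<^sub>2) |K\<^sub>1 K\<^sub>2. (K\<^sub>1, K\<^sub>2) \<in> P}
        \<union> {(\<tau>\<^sub>2 ` K\<^sub>2, \<tau>\<^sub>1 ` K\<^sub>1) |K\<^sub>1 K\<^sub>2. (K\<^sub>1, K\<^sub>2) \<in> P}\<rparr>)"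

text \<open>All stages of a construction carry the same vertex type. This is no restriction: each stage
  embeds into the next, so if the last one fits into \<open>'a\<close>, all of them do. Since the two initial
  vertices and the gluing maps are arbitrary, the class is closed under isomorphism.\<close>

inductive reflection_complex :: "'a bhyp \<Rightarrow> bool" where
  single_edge: "a \<noteq> b \<Longrightarrow> reflection_complex \<lparr>verts = {a, b}, edges = {{a, b}}, brel = {}\<rparr>"
| reflect: "reflection_complex M \<Longrightarrow> L \<in> edges M \<Longrightarrow> X \<subseteq> L \<Longrightarrow>
    gluing_maps (verts M) L X \<tau>\<^sub>1 \<tau>\<^sub>2 \<Longrightarrow> reflection_complex (reflect M L X \<tau>\<^sub>1 \<tau>\<^sub>2)"

definition frame :: "'a bhyp \<Rightarrow> 'a graph" where
  "frame M = \<lparr>gverts = verts M, gedges = {e \<in> edges M. card e = 2}\<rparr>"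

lemma reflection_complex_b_hypergraph: "reflection_complex M \<Longrightarrow> b_hypergraph M"
proof (induction rule: reflection_complex.induct)
  case (single_edge a b)
  then show ?case by (simp add: b_hypergraph_def sym_def)
next
  case (reflect M L X \<tau>\<^sub>1 \<tau>\<^sub>2)
  let ?M' = "reflect M L X \<tau>\<^sub>1 \<tau>\<^sub>2"
  note M = reflect.IH[unfolded b_hypergraph_def]
  have L: "L \<subseteq> verts M"
    using M reflect.hyps(2) by auto
  then have fL: "finite L"
    using M finite_subset by metis
  have sM: "(B, A) \<in> brel M" if "(A, B) \<in> brel M" for A B
    using M that by (auto simp: sym_def)
  have E: "K \<subseteq> verts M" if "K \<in> edges M" for K
    using M that by blast
  have B: "A \<subseteq> verts M" "B \<subseteq> verts M" if "(A, B) \<in> brel M" for A B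
    using M that by blast+
  have vM': "verts ?M' = \<tau>\<^sub>1 ` verts M \<union> \<tau>\<^sub>2 ` L"
    by (simp add: reflect_def sub_bhyp_def Let_def)
  have image_vM': "\<tau>\<^sub>1 ` K \<subseteq> verts ?M'" if "K \<subseteq> verts M" for K
    unfolding vM' using that by (intro le_supI1 image_mono)
  have image_vM'': "\<tau>\<^sub>2 ` K \<subseteq> verts ?M'" if "K \<subseteq> L" for K
    unfolding vM' using that by (intro le_supI2 image_mono)
  have "finite (verts ?M')"
    using M fL by (simp add: vM')
  moreover have "edges ?M' \<subseteq> Pow (verts ?M')"
  proof
    fix S assume "S \<in> edges ?M'"
    then consider (1) K where "K \<in> edges M" "S = \<tau>\<^sub>1 ` K"
      | (2) K where "K \<subseteq> L" "S = \<tau>\<^sub>2 ` K"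
      | (3) K\<^sub>1 K\<^sub>2 where "K\<^sub>1 \<in> edges M" "K\<^sub>2 \<subseteq> L" "S = \<tau>\<^sub>1 ` K\<^sub>1 \<union> \<tau>\<^sub>2 ` K\<^sub>2"
      unfolding reflect_def sub_bhyp_def reflected_pairs_def Let_def bhyp.simps by blast
    then show "S \<in> Pow (verts ?M')"
      by cases (simp_all only: Pow_iff Un_subset_iff E image_vM' image_vM'' simp_thms)
  qed
  moreover have "brel ?M' \<subseteq> Pow (verts ?M') \<times> Pow (verts ?M') \<and> sym (brel ?M')"
  proof -
    have "S \<subseteq> verts ?M' \<and> T \<subseteq> verts ?M' \<and> (T, S) \<in> brel ?M'" if "(S, T) \<in> brel ?M'" for S T
    proof -
      from that consider (1) A B where "(A, B) \<in> brel M" "S = \<tau>\<^sub>1 ` A" "T = \<tau>\<^sub>1 ` B"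
        | (2) A B where "(A, B) \<in> brel M" "A \<subseteq> L" "B \<subseteq> L" "S = \<tau>\<^sub>2 ` A" "T = \<tau>\<^sub>2 ` B"
        | (3) A B where "(A, B) \<in> reflected_pairs M L X" "S = \<tau>\<^sub>1 ` A" "T = \<tau>\<^sub>2 ` B"
        | (4) A B where "(A, B) \<in> reflected_pairs M L X" "T = \<tau>\<^sub>1 ` A" "S = \<tau>\<^sub>2 ` B"
        unfolding reflect_def sub_bhyp_def Let_def bhyp.simps Un_iff mem_Collect_eq prod.inject
        by (elim disjE exE conjE IntE SigmaE2) (simp_all only: Pow_iff)
      then show ?thesis
      proof cases
        case 1
        with sM[OF 1(1)] have "(T, S) \<in> brel ?M'"
          unfolding reflect_def Let_def bhyp.simps by blast
        then show ?thesis using 1(2,3) image_vM' B[OF 1(1)] by simp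
      next
        case 2
        with sM[OF 2(1)] have "(T, S) \<in> brel ?M'"
          unfolding reflect_def sub_bhyp_def Let_def bhyp.simps by blast
        then show ?thesis using 2(4,5) image_vM''[OF 2(2)] image_vM''[OF 2(3)] by simp
      next
        case 3
        then have "(T, S) \<in> brel ?M'"
          unfolding reflect_def Let_def bhyp.simps by blast
        then show ?thesis using 3 E image_vM' image_vM''
          by (simp add: reflected_pairs_def sub_bhyp_def)
      next
        case 4
        then have "(T, S) \<in> brel ?M'"
          unfolding reflect_def Let_def bhyp.simps by blast
        then show ?thesis using 4 E image_vM' image_vM''
          by (simp add: reflected_pairs_def sub_bhyp_def)
      qed
    qed
    then show ?thesis by (auto simp: sym_def)
  qed
  ultimately show ?case by (simp add: b_hypergraph_def)
qed


section \<open>Thickness\<close>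

text \<open>A vector of \<open>\<real>\<^bsup>2^V\<^esup>\<close> is represented by a function \<open>'a set \<Rightarrow> real\<close> vanishing outside \<open>Pow V\<close>,
  with vector operations taken pointwise. All vectors below have this property.\<close>

definition one_vec :: "'a set \<Rightarrow> 'a set \<Rightarrow> real" where
  "one_vec S = (\<lambda>T. if T = S then 1 else 0)"

definition t_vec :: "'a set \<Rightarrow> 'a set \<Rightarrow> 'a set \<Rightarrow> real" where
  "t_vec A B = (\<lambda>T. one_vec (A \<union> B) T - one_vec A T - one_vec B T + one_vec (A \<inter> B) T)"

text \<open>The span of the vectors \<open>t_vec A B\<close> with \<open>(A, B) \<in> R\<close>, for finite \<open>R\<close>.\<close>

definition W_space :: "('a set \<times> 'a set) set \<Rightarrow> ('a set \<Rightarrow> real) set" where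
  "W_space R = {w. \<exists>c :: 'a set \<times> 'a set \<Rightarrow> real. w = (\<lambda>T. \<Sum>(A, B)\<in>R. c (A, B) * t_vec A B T)}"

definition Q_cone :: "'a set \<Rightarrow> ('a set \<Rightarrow> real) set" where
  "Q_cone V = {q. \<exists>(r :: real) (c :: 'a set \<times> 'a set \<Rightarrow> real) (d :: 'a set \<Rightarrow> real).
     (\<forall>A\<in>Pow V. \<forall>B\<in>Pow V. 0 \<le> c (A, B)) \<and> (\<forall>A\<in>Pow V. 0 \<le> d A) \<and>
     q = (\<lambda>T. r * one_vec {} T + (\<Sum>(A, B)\<in>Pow V \<times> Pow V. c (A, B) * t_vec A B T)
            + (\<Sum>A\<in>Pow V. d A * one_vec A T))}"

definition induced_subgraph :: "'a graph \<Rightarrow> 'a set \<Rightarrow> 'a graph" where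
  "induced_subgraph H X = \<lparr>gverts = X, gedges = {e \<in> gedges H. e \<subseteq> X}\<rparr>"

definition degree :: "'a graph \<Rightarrow> 'a \<Rightarrow> nat" where
  "degree F v = card {e \<in> gedges F. v \<in> e}"

definition h_vec :: "'a graph \<Rightarrow> 'a set \<Rightarrow> 'a set \<Rightarrow> real" where
  "h_vec H X = (let F = induced_subgraph H X in
     (\<lambda>T. - one_vec X T + (\<Sum>e\<in>gedges F. one_vec e T)
          - (\<Sum>v\<in>X. (real (degree F v) - 1) * one_vec {v} T)))"

definition thick :: "'a bhyp \<Rightarrow> bool" where
  "thick M \<longleftrightarrow> (\<exists>w\<in>W_space (brel M). \<exists>q\<in>Q_cone (verts M).
     h_vec (frame M) (verts M) = (\<lambda>T. w T + q T))"

definition thick_graph :: "'a graph \<Rightarrow> bool" where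
  "thick_graph H \<longleftrightarrow> (\<exists>M. reflection_complex M \<and> thick M \<and> H = frame M)"

end

theory Submission
  imports Defs
begin

text \<open>
  The entropy method. Starting from a uniformly random directed edge of \<open>G\<close>, each reflection along
  \<open>(L, X)\<close> is followed by gluing a copy of the current random map restricted to \<open>L\<close>, conditionally
  independent given its values on \<open>X\<close>. This yields a random map \<open>V \<rightarrow> V(G)\<close> whose marginal on every
  edge of the frame is uniform on the directed edges of \<open>G\<close>, and such that \<open>A\<close> and \<open>B\<close> are
  conditionally independent given \<open>A \<inter> B\<close> for all pairs \<open>(A, B)\<close> of the relation. Let
  \<open>D S = \<bar>S\<bar> ln \<bar>V(G)\<bar> - ent S\<close> be the divergence of the marginal on \<open>S\<close> from the uniform
  distribution. Then \<open>D\<close> is nonnegative, supermodular, and modular on the pairs of the relation, so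
  extending \<open>D\<close> linearly to \<open>\<real>\<^bsup>2^V\<^esup>\<close> gives a functional that vanishes on \<open>W_space\<close> and is
  nonnegative on \<open>Q_cone\<close>. Applied to the thickness condition it gives
  \<open>D V \<le> (\<Sum>e. D e) - (\<Sum>v. (deg v - 1) D {v}) \<le> - \<bar>E(H)\<bar> ln t(e, G)\<close>, as no vertex is isolated,
  whereas \<open>D V \<ge> - ln t(H, G)\<close> because the random map is supported on homomorphisms.
\<close>

section \<open>Marginals and entropies of a random map\<close>

definition agree :: "'x set \<Rightarrow> ('x \<Rightarrow> 'y) \<Rightarrow> ('x \<Rightarrow> 'y) set" where
  "agree S f = {g. \<forall>x\<in>S. g x = f x}"

text \<open>The marginal is evaluated at a total map, of which only the values on \<open>S\<close>
  matter. All marginals thus have the same argument type, and no space of partial maps is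
  needed.\<close>

definition marg :: "('x \<Rightarrow> 'y) pmf \<Rightarrow> 'x set \<Rightarrow> ('x \<Rightarrow> 'y) \<Rightarrow> real" where
  "marg \<mu> S f = measure_pmf.prob \<mu> (agree S f)"

text \<open>Shannon entropy of the marginal on \<open>S\<close>, written as an expectation under
  \<open>\<mu>\<close> itself. Entropies for different \<open>S\<close> are then sums over the same
  support and combine termwise.\<close>

definition ent :: "('x \<Rightarrow> 'y) pmf \<Rightarrow> 'x set \<Rightarrow> real" where
  "ent \<mu> S = (\<Sum>f\<in>set_pmf \<mu>. pmf \<mu> f * - ln (marg \<mu> S f))"

text \<open>Conditional independence given the values on the intersection, multiplied out so that
  null events need no exception.\<close>

definition cond_indep :: "('x \<Rightarrow> 'y) pmf \<Rightarrow> 'x set \<Rightarrow> 'x set \<Rightarrow> bool" where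
  "cond_indep \<mu> A B \<longleftrightarrow>
     (\<forall>f. marg \<mu> (A \<union> B) f * marg \<mu> (A \<inter> B) f = marg \<mu> A f * marg \<mu> B f)"

lemma agree_refl [simp]: "f \<in> agree S f"
  by (simp add: agree_def)

lemma agree_cong: "g \<in> agree S f \<Longrightarrow> agree S g = agree S f"
  by (auto simp: agree_def)

lemma agree_mono: "A \<subseteq> B \<Longrightarrow> agree B f \<subseteq> agree A f"
  by (auto simp: agree_def)

lemma agree_restrict: "g \<in> agree S f \<longleftrightarrow> restrict g S = restrict f S"
  by (auto simp: agree_def restrict_def fun_eq_iff)

lemma marg_nonneg [simp]: "0 \<le> marg \<mu> S f"
  by (simp add: marg_def)

lemma marg_pos: "f \<in> set_pmf \<mu> \<Longrightarrow> 0 < marg \<mu> S f"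
  using agree_refl[of f S] by (auto simp: marg_def less_le measure_pmf_zero_iff)

lemma marg_cong: "g \<in> agree S f \<Longrightarrow> marg \<mu> S g = marg \<mu> S f"
  by (simp add: marg_def agree_cong)

lemma marg_antimono: "A \<subseteq> B \<Longrightarrow> marg \<mu> B f \<le> marg \<mu> A f"
  unfolding marg_def by (rule measure_pmf.finite_measure_mono) (auto simp: agree_mono)

lemma marg_eq_sum:
  assumes "finite (set_pmf \<mu>)"
  shows "marg \<mu> S f = (\<Sum>g\<in>set_pmf \<mu>. pmf \<mu> g * indicator (agree S f) g)"
proof -
  have "marg \<mu> S f = measure_pmf.prob \<mu> (agree S f \<inter> set_pmf \<mu>)"
    by (simp add: marg_def measure_Int_set_pmf)
  also have "\<dots> = (\<Sum>g\<in>agree S f \<inter> set_pmf \<mu>. pmf \<mu> g)"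
    using assms by (simp add: measure_measure_pmf_finite)
  also have "\<dots> = (\<Sum>g\<in>set_pmf \<mu>. pmf \<mu> g * indicator (agree S f) g)"
    using assms by (intro sum.mono_neutral_cong_left) (auto simp: indicator_def)
  finally show ?thesis .
qed

lemma ent_empty [simp]: "ent \<mu> {} = 0"
  by (simp add: ent_def marg_def agree_def)

section \<open>Entropy is at most the logarithm of the number of values\<close>

text \<open>Group the support by restriction to \<open>S\<close>. The marginal is constant on each
  fibre and equals its total mass, so every fibre contributes 1.\<close>

lemma sum_inverse_marg:
  assumes "finite (set_pmf \<mu>)"
  shows "(\<Sum>f\<in>set_pmf \<mu>. pmf \<mu> f / marg \<mu> S f) = card ((\<lambda>f. restrict f S) ` set_pmf \<mu>)"
proof -
  let ?r = "\<lambda>f. restrict f S"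
  have "(\<Sum>f\<in>set_pmf \<mu>. pmf \<mu> f / marg \<mu> S f)
      = (\<Sum>k\<in>?r ` set_pmf \<mu>. \<Sum>f\<in>{f \<in> set_pmf \<mu>. ?r f = k}. pmf \<mu> f / marg \<mu> S f)"
    using assms by (rule sum.image_gen)
  also have "\<dots> = (\<Sum>k\<in>?r ` set_pmf \<mu>. 1)"
  proof (rule sum.cong[OF refl])
    fix k assume "k \<in> ?r ` set_pmf \<mu>"
    then obtain g where g: "g \<in> set_pmf \<mu>" "k = ?r g" by blast
    then have eq: "{f \<in> set_pmf \<mu>. ?r f = k} = agree S g \<inter> set_pmf \<mu>"
      by (auto simp: agree_restrict)
    have "(\<Sum>f\<in>{f \<in> set_pmf \<mu>. ?r f = k}. pmf \<mu> f / marg \<mu> S f)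
        = (\<Sum>f\<in>agree S g \<inter> set_pmf \<mu>. pmf \<mu> f / marg \<mu> S g)"
      unfolding eq
    proof (rule sum.cong[OF refl])
      fix f assume "f \<in> agree S g \<inter> set_pmf \<mu>"
      then show "pmf \<mu> f / marg \<mu> S f = pmf \<mu> f / marg \<mu> S g"
        using marg_cong[of f S g \<mu>] by simp
    qed
    also have "\<dots> = (\<Sum>f\<in>agree S g \<inter> set_pmf \<mu>. pmf \<mu> f) / marg \<mu> S g"
      by (simp add: sum_divide_distrib)
    also have "(\<Sum>f\<in>agree S g \<inter> set_pmf \<mu>. pmf \<mu> f) = marg \<mu> S g"
      using assms measure_Int_set_pmf[of \<mu> "agree S g"]
      by (simp add: marg_def measure_measure_pmf_finite)
    also have "marg \<mu> S g / marg \<mu> S g = 1"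
      using marg_pos[OF g(1), of S] by simp
    finally show "(\<Sum>f\<in>{f \<in> set_pmf \<mu>. ?r f = k}. pmf \<mu> f / marg \<mu> S f) = 1" .
  qed
  finally show ?thesis by simp
qed

text \<open>Gibbs' inequality: apply ln x \<le> x - 1 to x = 1 / (marginal * N) with N =
  \<open>card T\<close>. The mean of x is the number of restrictions that occur, divided by N, hence
  at most 1.\<close>

lemma ent_le_ln_card:
  assumes fin: "finite (set_pmf \<mu>)"
    and T: "finite T" "(\<lambda>f. restrict f S) ` set_pmf \<mu> \<subseteq> T"
  shows "ent \<mu> S \<le> ln (card T)"
proof -
  define N where "N = real (card T)"
  have "T \<noteq> {}" using T set_pmf_not_empty[of \<mu>] by auto
  then have N: "N > 0" using T by (simp add: N_def card_gt_0_iff)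
  have "(\<Sum>f\<in>set_pmf \<mu>. pmf \<mu> f * (- ln (marg \<mu> S f) - ln N))
     \<le> (\<Sum>f\<in>set_pmf \<mu>. pmf \<mu> f / marg \<mu> S f * (1 / N) - pmf \<mu> f)"
  proof (rule sum_mono)
    fix f assume f: "f \<in> set_pmf \<mu>"
    note p = marg_pos[OF f, of S]
    have "- ln (marg \<mu> S f) - ln N = ln (1 / (marg \<mu> S f * N))"
      using p N by (simp add: ln_div ln_mult)
    also have "\<dots> \<le> 1 / (marg \<mu> S f * N) - 1"
      using p N by (intro ln_le_minus_one) simp
    finally have "pmf \<mu> f * (- ln (marg \<mu> S f) - ln N)
        \<le> pmf \<mu> f * (1 / (marg \<mu> S f * N) - 1)"
      by (rule mult_left_mono) simp
    then show "pmf \<mu> f * (- ln (marg \<mu> S f) - ln N)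
        \<le> pmf \<mu> f / marg \<mu> S f * (1 / N) - pmf \<mu> f"
      by (simp add: field_simps)
  qed
  also have "\<dots> = card ((\<lambda>f. restrict f S) ` set_pmf \<mu>) * (1 / N) - 1"
    unfolding sum_subtractf sum_distrib_right[symmetric] sum_inverse_marg[OF fin]
    using fin by (simp add: sum_pmf_eq_1)
  also have "\<dots> \<le> 0"
    using card_mono[OF T] N by (simp add: N_def field_simps)
  finally have "ent \<mu> S - ln N \<le> 0"
    using fin
    by (simp add: ent_def right_diff_distrib sum_subtractf sum_pmf_eq_1 flip: sum_distrib_right)
  then show ?thesis by (simp add: N_def)
qed

section \<open>Submodularity of entropy\<close>

text \<open>Expanding the numerator as a double sum over \<open>g, g'\<close>, the sum over \<open>f\<close> collapses, because
  an \<open>f\<close> agreeing with \<open>g\<close> on \<open>A\<close> and with \<open>g'\<close> on \<open>B\<close> is determined on \<open>A \<union> B\<close>.\<close>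

lemma sum_marg_quotient_le_1:
  assumes fin: "finite (set_pmf \<mu>)"
  shows "(\<Sum>f\<in>set_pmf \<mu>. pmf \<mu> f * (marg \<mu> A f * marg \<mu> B f) /
            (marg \<mu> (A \<union> B) f * marg \<mu> (A \<inter> B) f)) \<le> 1"
proof -
  let ?S = "set_pmf \<mu>" and ?p = "pmf \<mu>"
  let ?i = "\<lambda>S f g. indicator (agree S f) g :: real"
  define Q where "Q f = marg \<mu> (A \<union> B) f * marg \<mu> (A \<inter> B) f" for f
  have inner: "(\<Sum>f\<in>?S. ?p f * ?i A f g * ?i B f g' / Q f)
      \<le> ?i (A \<inter> B) g g' / marg \<mu> (A \<inter> B) g" if g: "g \<in> ?S" for g g'
  proof (cases "\<exists>h\<in>?S. g \<in> agree A h \<and> g' \<in> agree B h")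
    case True
    then obtain h where h: "h \<in> ?S" "g \<in> agree A h" "g' \<in> agree B h" by blast
    have hg: "h \<in> agree (A \<inter> B) g" and gg: "g' \<in> agree (A \<inter> B) g"
      using h by (auto simp: agree_def)
    have iff: "g \<in> agree A f \<and> g' \<in> agree B f \<longleftrightarrow> f \<in> agree (A \<union> B) h" for f
      using h by (auto simp: agree_def)
    have Q: "Q f = Q h" if "f \<in> agree (A \<union> B) h" for f
    proof -
      have "f \<in> agree (A \<inter> B) h"
        using that by (auto simp: agree_def)
      then show ?thesis
        using that marg_cong[of f "A \<union> B" h \<mu>] marg_cong[of f "A \<inter> B" h \<mu>] unfolding Q_def by simp
    qed
    have "(\<Sum>f\<in>?S. ?p f * ?i A f g * ?i B f g' / Q f)
        = (\<Sum>f\<in>?S. ?p f * ?i (A \<union> B) h f / Q h)"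
    proof (rule sum.cong[OF refl])
      fix f
      show "?p f * ?i A f g * ?i B f g' / Q f = ?p f * ?i (A \<union> B) h f / Q h"
        using iff[of f] Q[of f] by (cases "f \<in> agree (A \<union> B) h") (auto simp: indicator_def)
    qed
    also have "\<dots> = marg \<mu> (A \<union> B) h / Q h"
      by (simp add: marg_eq_sum[OF fin] sum_divide_distrib)
    also have "\<dots> = 1 / marg \<mu> (A \<inter> B) h"
      using marg_pos[OF h(1), of "A \<union> B"] by (simp add: Q_def)
    also have "\<dots> = ?i (A \<inter> B) g g' / marg \<mu> (A \<inter> B) g"
      using gg by (simp add: marg_cong[OF hg])
    finally show ?thesis by simp
  next
    \<comment> \<open>The sum may vanish although \<open>g\<close> and \<open>g'\<close> agree on
      the intersection: the support need not contain a common extension. This is why only an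
      inequality holds.\<close>
    case False
    then have "(\<Sum>f\<in>?S. ?p f * ?i A f g * ?i B f g' / Q f) = 0"
      by (intro sum.neutral) (auto simp: indicator_def)
    then show ?thesis by simp
  qed
  have "(\<Sum>f\<in>?S. ?p f * (marg \<mu> A f * marg \<mu> B f) / Q f)
      = (\<Sum>f\<in>?S. \<Sum>g\<in>?S. \<Sum>g'\<in>?S. ?p g * ?p g' * (?p f * ?i A f g * ?i B f g' / Q f))"
  proof (rule sum.cong[OF refl])
    fix f
    have "marg \<mu> A f * marg \<mu> B f
        = (\<Sum>g\<in>?S. \<Sum>g'\<in>?S. (?p g * ?i A f g) * (?p g' * ?i B f g'))"
      by (simp only: marg_eq_sum[OF fin] sum_product)
    then have "?p f * (marg \<mu> A f * marg \<mu> B f) / Q f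
        = (\<Sum>g\<in>?S. \<Sum>g'\<in>?S. ?p f * ((?p g * ?i A f g) * (?p g' * ?i B f g')) / Q f)"
      by (simp only: sum_distrib_left sum_divide_distrib)
    also have "\<dots> = (\<Sum>g\<in>?S. \<Sum>g'\<in>?S. ?p g * ?p g' * (?p f * ?i A f g * ?i B f g' / Q f))"
      by (rule sum.cong[OF refl], rule sum.cong[OF refl]) (simp only: times_divide_eq_right mult_ac)
    finally show "?p f * (marg \<mu> A f * marg \<mu> B f) / Q f
        = (\<Sum>g\<in>?S. \<Sum>g'\<in>?S. ?p g * ?p g' * (?p f * ?i A f g * ?i B f g' / Q f))" .
  qed
  also have "\<dots> = (\<Sum>g\<in>?S. \<Sum>f\<in>?S. \<Sum>g'\<in>?S. ?p g * ?p g' * (?p f * ?i A f g * ?i B f g' / Q f))"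
    by (rule sum.swap)
  also have "\<dots> = (\<Sum>g\<in>?S. \<Sum>g'\<in>?S. ?p g * ?p g' * (\<Sum>f\<in>?S. ?p f * ?i A f g * ?i B f g' / Q f))"
    unfolding sum_distrib_left by (rule sum.cong[OF refl], rule sum.swap)
  also have "\<dots> \<le> (\<Sum>g\<in>?S. \<Sum>g'\<in>?S. ?p g * ?p g' * (?i (A \<inter> B) g g' / marg \<mu> (A \<inter> B) g))"
    using inner by (intro sum_mono mult_left_mono) auto
  also have "\<dots> = (\<Sum>g\<in>?S. ?p g * ((\<Sum>g'\<in>?S. ?p g' * ?i (A \<inter> B) g g') / marg \<mu> (A \<inter> B) g))"
    unfolding sum_distrib_left sum_divide_distrib
    by (rule sum.cong[OF refl], rule sum.cong[OF refl]) (simp only: times_divide_eq_right mult_ac)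
  also have "\<dots> = (\<Sum>g\<in>?S. ?p g * (marg \<mu> (A \<inter> B) g / marg \<mu> (A \<inter> B) g))"
    by (simp only: marg_eq_sum[OF fin])
  also have "\<dots> = (\<Sum>g\<in>?S. ?p g)"
  proof (rule sum.cong[OF refl])
    fix g assume "g \<in> ?S"
    then show "?p g * (marg \<mu> (A \<inter> B) g / marg \<mu> (A \<inter> B) g) = ?p g"
      using marg_pos[of g \<mu> "A \<inter> B"] by simp
  qed
  also have "\<dots> = 1" using fin by (simp add: sum_pmf_eq_1)
  finally show ?thesis by (simp add: Q_def)
qed

text \<open>This is the conditional mutual information of \<open>A\<close> and \<open>B\<close>
  given their intersection. Its sign gives submodularity, its vanishing the equality case.\<close>

lemma ent_diff:
  "ent \<mu> A + ent \<mu> B - ent \<mu> (A \<union> B) - ent \<mu> (A \<inter> B) =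
     - (\<Sum>f\<in>set_pmf \<mu>. pmf \<mu> f * ln ((marg \<mu> A f * marg \<mu> B f) /
            (marg \<mu> (A \<union> B) f * marg \<mu> (A \<inter> B) f)))"
  unfolding ent_def sum.distrib[symmetric] sum_subtractf[symmetric] sum_negf[symmetric]
proof (rule sum.cong[OF refl])
  fix f assume f: "f \<in> set_pmf \<mu>"
  note p = marg_pos[OF f, of A] marg_pos[OF f, of B]
    marg_pos[OF f, of "A \<union> B"] marg_pos[OF f, of "A \<inter> B"]
  then show "pmf \<mu> f * - ln (marg \<mu> A f) + pmf \<mu> f * - ln (marg \<mu> B f)
      - pmf \<mu> f * - ln (marg \<mu> (A \<union> B) f) - pmf \<mu> f * - ln (marg \<mu> (A \<inter> B) f)
      = - (pmf \<mu> f * ln ((marg \<mu> A f * marg \<mu> B f) /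
            (marg \<mu> (A \<union> B) f * marg \<mu> (A \<inter> B) f)))"
    by (simp add: ln_div ln_mult algebra_simps)
qed

text \<open>With q the quotient in \<open>ent_diff\<close>, ln q \<le> q - 1, and the mean of q is
  at most 1.\<close>

lemma ent_submodular:
  assumes fin: "finite (set_pmf \<mu>)"
  shows "ent \<mu> (A \<union> B) + ent \<mu> (A \<inter> B) \<le> ent \<mu> A + ent \<mu> B"
proof -
  define q where "q f = (marg \<mu> A f * marg \<mu> B f) /
            (marg \<mu> (A \<union> B) f * marg \<mu> (A \<inter> B) f)" for f
  have "(\<Sum>f\<in>set_pmf \<mu>. pmf \<mu> f * ln (q f)) \<le> (\<Sum>f\<in>set_pmf \<mu>. pmf \<mu> f * (q f - 1))"
  proof (intro sum_mono mult_left_mono pmf_nonneg ln_le_minus_one)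
    fix f assume "f \<in> set_pmf \<mu>"
    then show "0 < q f" by (simp add: q_def marg_pos)
  qed
  also have "\<dots> = (\<Sum>f\<in>set_pmf \<mu>. pmf \<mu> f * q f) - 1"
    using fin by (simp add: algebra_simps sum_subtractf sum_pmf_eq_1)
  also have "\<dots> \<le> 0"
    using sum_marg_quotient_le_1[OF fin, of A B] by (simp add: q_def)
  finally show ?thesis
    using ent_diff[of \<mu> A B] by (simp add: q_def)
qed

lemma cond_indep_ent:
  assumes "cond_indep \<mu> A B"
  shows "ent \<mu> (A \<union> B) + ent \<mu> (A \<inter> B) = ent \<mu> A + ent \<mu> B"
proof -
  have "(\<Sum>f\<in>set_pmf \<mu>. pmf \<mu> f * ln ((marg \<mu> A f * marg \<mu> B f) /
            (marg \<mu> (A \<union> B) f * marg \<mu> (A \<inter> B) f))) = 0"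
  proof (rule sum.neutral, rule ballI)
    fix f assume f: "f \<in> set_pmf \<mu>"
    have "marg \<mu> (A \<union> B) f * marg \<mu> (A \<inter> B) f \<noteq> 0"
      using marg_pos[OF f, of "A \<union> B"] marg_pos[OF f, of "A \<inter> B"] by simp
    then have "(marg \<mu> A f * marg \<mu> B f) / (marg \<mu> (A \<union> B) f * marg \<mu> (A \<inter> B) f) = 1"
      using assms unfolding cond_indep_def by (metis divide_self)
    then show "pmf \<mu> f * ln ((marg \<mu> A f * marg \<mu> B f) /
            (marg \<mu> (A \<union> B) f * marg \<mu> (A \<inter> B) f)) = 0"
      by simp
  qed
  then show ?thesis
    using ent_diff[of \<mu> A B] by linarith
qed

section \<open>Conditionally independent gluing\<close>

text \<open>On the overlap the first map takes precedence; this is harmless as soon as both maps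
  agree on \<open>X\<close>.\<close>

definition glue ::
    "'a set \<Rightarrow> 'a set \<Rightarrow> ('a \<Rightarrow> 'b) \<Rightarrow> ('a \<Rightarrow> 'b) \<Rightarrow> ('a \<Rightarrow> 'c) \<Rightarrow> ('a \<Rightarrow> 'c) \<Rightarrow> 'b \<Rightarrow> 'c" where
  "glue V L \<tau>\<^sub>1 \<tau>\<^sub>2 f g =
     (\<lambda>z. if z \<in> \<tau>\<^sub>1 ` V then f (the_inv_into V \<tau>\<^sub>1 z) else g (the_inv_into L \<tau>\<^sub>2 z))"

text \<open>First draw \<open>f\<close>, then a second map from the same law conditioned to agree
  with \<open>f\<close> on \<open>X\<close>. It is drawn as a total map, although only its
  restriction to \<open>L\<close> is of interest.\<close>

definition reflect_pmf ::
    "'a set \<Rightarrow> 'a set \<Rightarrow> 'a set \<Rightarrow> ('a \<Rightarrow> 'b) \<Rightarrow> ('a \<Rightarrow> 'b) \<Rightarrow> ('a \<Rightarrow> 'c) pmf \<Rightarrow> ('b \<Rightarrow> 'c) pmf" where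
  "reflect_pmf V L X \<tau>\<^sub>1 \<tau>\<^sub>2 \<mu> =
     bind_pmf \<mu> (\<lambda>f. map_pmf (glue V L \<tau>\<^sub>1 \<tau>\<^sub>2 f) (cond_pmf \<mu> (agree X f)))"

section \<open>Mixtures and conditioning\<close>

lemma measure_bind_pmf:
  "measure_pmf.prob (bind_pmf M N) A = (\<integral>x. measure_pmf.prob (N x) A \<partial>measure_pmf M)"
  unfolding bind_pmf.rep_eq
  by (subst measure_pmf.measure_bind[where N = "count_space UNIV"]) (auto simp: measure_subprob)

lemma measure_cond_pmf:
  assumes "set_pmf p \<inter> S \<noteq> {}"
  shows "measure_pmf.prob (cond_pmf p S) A = measure_pmf.prob p (S \<inter> A) / measure_pmf.prob p S"
  unfolding cond_pmf.rep_eq[OF assms]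
  using assms by (intro measure_uniform_measure) (auto simp: emeasure_measure_pmf_not_zero)

lemma support_inter_agree: "f \<in> set_pmf \<mu> \<Longrightarrow> set_pmf \<mu> \<inter> agree X f \<noteq> {}"
  using agree_refl by blast

text \<open>Resampling a map given its values on \<open>X\<close> preserves its law. Agreement on
  \<open>X\<close> is an equivalence relation, so the classes of \<open>f\<close> and
  \<open>g\<close> coincide, as the cancellation rule demands.\<close>

lemma bind_cond_agree:
  fixes \<mu> :: "('a \<Rightarrow> 'b) pmf"
  shows "bind_pmf \<mu> (\<lambda>f. cond_pmf \<mu> (agree X f)) = \<mu>"
proof -
  have "bind_pmf \<mu> (\<lambda>f. cond_pmf \<mu> {g. g \<in> agree X f}) = \<mu>"
  proof (rule bind_cond_pmf_cancel)
    fix f g :: "'a \<Rightarrow> 'b" assume "g \<in> agree X f"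
    then have "{g. g \<in> agree X f} = {f. g \<in> agree X f}"
      by (auto simp: agree_def)
    then show "measure_pmf.prob \<mu> {g. g \<in> agree X f} = measure_pmf.prob \<mu> {f. g \<in> agree X f}"
      by simp
  qed (use agree_refl in blast)+
  then show ?thesis by simp
qed

lemma gluing_mapsD:
  assumes "gluing_maps V L X \<tau>\<^sub>1 \<tau>\<^sub>2"
  shows "inj_on \<tau>\<^sub>1 V" "inj_on \<tau>\<^sub>2 L" "\<And>x. x \<in> X \<Longrightarrow> \<tau>\<^sub>2 x = \<tau>\<^sub>1 x"
    "\<tau>\<^sub>1 ` V \<inter> \<tau>\<^sub>2 ` L = \<tau>\<^sub>1 ` X"
  using assms by (auto simp: gluing_maps_def)

lemma glue_fst:
  assumes "gluing_maps V L X \<tau>\<^sub>1 \<tau>\<^sub>2" "x \<in> V"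
  shows "glue V L \<tau>\<^sub>1 \<tau>\<^sub>2 f g (\<tau>\<^sub>1 x) = f x"
  using assms(2) gluing_mapsD(1)[OF assms(1)] by (simp add: glue_def the_inv_into_f_f)

text \<open>A point of the overlap is the common image of some x in \<open>X\<close>. Injectivity of
  \<open>\<tau>\<^sub>2\<close> forces \<open>y\<close> = x, where \<open>f\<close> and
  \<open>g\<close> agree.\<close>

lemma glue_snd:
  assumes G: "gluing_maps V L X \<tau>\<^sub>1 \<tau>\<^sub>2" and X: "X \<subseteq> L" "L \<subseteq> V"
    and g: "g \<in> agree X f" and y: "y \<in> L"
  shows "glue V L \<tau>\<^sub>1 \<tau>\<^sub>2 f g (\<tau>\<^sub>2 y) = g y"
proof (cases "\<tau>\<^sub>2 y \<in> \<tau>\<^sub>1 ` V")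
  case True
  then have "\<tau>\<^sub>2 y \<in> \<tau>\<^sub>1 ` X"
    using gluing_mapsD(4)[OF G] y by blast
  then obtain x where x: "x \<in> X" "\<tau>\<^sub>2 y = \<tau>\<^sub>1 x" by blast
  then have "\<tau>\<^sub>2 y = \<tau>\<^sub>2 x" using gluing_mapsD(3)[OF G] by simp
  then have "y = x" using gluing_mapsD(2)[OF G] y x(1) X by (auto dest: inj_onD)
  moreover have "x \<in> V" using x X by blast
  ultimately show ?thesis
    using glue_fst[OF G] x g by (auto simp: agree_def)
next
  case False
  then show ?thesis
    using y gluing_mapsD(2)[OF G] by (simp add: glue_def the_inv_into_f_f)
qed

section \<open>Marginals of the glued random map\<close>

locale gluing =
  fixes V L X :: "'a set" and \<tau>\<^sub>1 \<tau>\<^sub>2 :: "'a \<Rightarrow> 'b" and \<mu> :: "('a \<Rightarrow> 'c) pmf"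
  assumes G: "gluing_maps V L X \<tau>\<^sub>1 \<tau>\<^sub>2" and XL: "X \<subseteq> L" and LV: "L \<subseteq> V"
begin

abbreviation "\<mu>' \<equiv> reflect_pmf V L X \<tau>\<^sub>1 \<tau>\<^sub>2 \<mu>"

lemma glue_agree_iff:
  assumes "A \<subseteq> V" "B \<subseteq> L" "g \<in> agree X f"
  shows "glue V L \<tau>\<^sub>1 \<tau>\<^sub>2 f g \<in> agree (\<tau>\<^sub>1 ` A \<union> \<tau>\<^sub>2 ` B) k
     \<longleftrightarrow> f \<in> agree A (k \<circ> \<tau>\<^sub>1) \<and> g \<in> agree B (k \<circ> \<tau>\<^sub>2)"
proof -
  have "glue V L \<tau>\<^sub>1 \<tau>\<^sub>2 f g (\<tau>\<^sub>1 x) = f x" if "x \<in> A" for x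
    using glue_fst[OF G] that assms by blast
  moreover have "glue V L \<tau>\<^sub>1 \<tau>\<^sub>2 f g (\<tau>\<^sub>2 x) = g x" if "x \<in> B" for x
    using glue_snd[OF G XL LV assms(3)] that assms by blast
  ultimately show ?thesis by (auto simp: agree_def)
qed

text \<open>Once \<open>f\<close> is fixed, the event splits into a condition on \<open>f\<close>
  and one on the second map. All other marginals of the glued law are special cases of this
  formula.\<close>

lemma marg_reflect:
  assumes AB: "A \<subseteq> V" "B \<subseteq> L"
  shows "marg \<mu>' (\<tau>\<^sub>1 ` A \<union> \<tau>\<^sub>2 ` B) k =
    (\<integral>f. indicator (agree A (k \<circ> \<tau>\<^sub>1)) f *
        measure_pmf.prob (cond_pmf \<mu> (agree X f)) (agree B (k \<circ> \<tau>\<^sub>2)) \<partial>measure_pmf \<mu>)"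
proof -
  have "marg \<mu>' (\<tau>\<^sub>1 ` A \<union> \<tau>\<^sub>2 ` B) k =
      (\<integral>f. measure_pmf.prob (cond_pmf \<mu> (agree X f))
        (glue V L \<tau>\<^sub>1 \<tau>\<^sub>2 f -` agree (\<tau>\<^sub>1 ` A \<union> \<tau>\<^sub>2 ` B) k) \<partial>measure_pmf \<mu>)"
    by (simp add: marg_def reflect_pmf_def measure_bind_pmf)
  also have "\<dots> = (\<integral>f. indicator (agree A (k \<circ> \<tau>\<^sub>1)) f *
        measure_pmf.prob (cond_pmf \<mu> (agree X f)) (agree B (k \<circ> \<tau>\<^sub>2)) \<partial>measure_pmf \<mu>)"
  proof (rule integral_cong_AE, simp, simp, rule AE_pmfI)
    fix f assume f: "f \<in> set_pmf \<mu>"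
    let ?c = "cond_pmf \<mu> (agree X f)"
    have "measure_pmf.prob ?c (glue V L \<tau>\<^sub>1 \<tau>\<^sub>2 f -` agree (\<tau>\<^sub>1 ` A \<union> \<tau>\<^sub>2 ` B) k)
        = measure_pmf.prob ?c {g. f \<in> agree A (k \<circ> \<tau>\<^sub>1) \<and> g \<in> agree B (k \<circ> \<tau>\<^sub>2)}"
    proof (rule measure_pmf.finite_measure_eq_AE, rule AE_pmfI)
      fix g assume "g \<in> set_pmf ?c"
      then have "g \<in> agree X f"
        using set_cond_pmf[OF support_inter_agree[OF f]] by blast
      then show "g \<in> glue V L \<tau>\<^sub>1 \<tau>\<^sub>2 f -` agree (\<tau>\<^sub>1 ` A \<union> \<tau>\<^sub>2 ` B) k \<longleftrightarrow>
          g \<in> {g. f \<in> agree A (k \<circ> \<tau>\<^sub>1) \<and> g \<in> agree B (k \<circ> \<tau>\<^sub>2)}"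
        using glue_agree_iff[OF AB] by simp
    qed auto
    then show "measure_pmf.prob ?c (glue V L \<tau>\<^sub>1 \<tau>\<^sub>2 f -` agree (\<tau>\<^sub>1 ` A \<union> \<tau>\<^sub>2 ` B) k)
        = indicator (agree A (k \<circ> \<tau>\<^sub>1)) f * measure_pmf.prob ?c (agree B (k \<circ> \<tau>\<^sub>2))"
      by (cases "f \<in> agree A (k \<circ> \<tau>\<^sub>1)") auto
  qed
  finally show ?thesis .
qed

lemma marg_reflect_fst:
  assumes "A \<subseteq> V"
  shows "marg \<mu>' (\<tau>\<^sub>1 ` A) k = marg \<mu> A (k \<circ> \<tau>\<^sub>1)"
  using marg_reflect[OF assms, of "{}" k] by (simp add: marg_def agree_def[of "{}"])

text \<open>The second copy is a resampled map, so its law is again \<open>\<mu>\<close> by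
  \<open>bind_cond_agree\<close>.\<close>

lemma marg_reflect_snd:
  assumes "B \<subseteq> L"
  shows "marg \<mu>' (\<tau>\<^sub>2 ` B) k = marg \<mu> B (k \<circ> \<tau>\<^sub>2)"
proof -
  have "marg \<mu>' (\<tau>\<^sub>2 ` B) k
      = measure_pmf.prob (bind_pmf \<mu> (\<lambda>f. cond_pmf \<mu> (agree X f))) (agree B (k \<circ> \<tau>\<^sub>2))"
    using marg_reflect[OF _ assms, of "{}" k] by (simp add: agree_def[of "{}"] measure_bind_pmf)
  then show ?thesis
    by (simp add: bind_cond_agree marg_def)
qed

text \<open>Since \<open>A\<close> contains \<open>X\<close>, the conditioning event is the same for
  every \<open>f\<close> that contributes, so the conditional probability leaves the integral as a
  constant.\<close>

lemma marg_reflect_Un: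
  assumes "A \<subseteq> V" "B \<subseteq> L" "X \<subseteq> A" "X \<subseteq> B"
  shows "marg \<mu>' (\<tau>\<^sub>1 ` A \<union> \<tau>\<^sub>2 ` B) k =
     marg \<mu> A (k \<circ> \<tau>\<^sub>1) * (marg \<mu> B (k \<circ> \<tau>\<^sub>2) / marg \<mu> X (k \<circ> \<tau>\<^sub>1))"
proof -
  have "marg \<mu>' (\<tau>\<^sub>1 ` A \<union> \<tau>\<^sub>2 ` B) k = (\<integral>f. indicator (agree A (k \<circ> \<tau>\<^sub>1)) f *
      (marg \<mu> B (k \<circ> \<tau>\<^sub>2) / marg \<mu> X (k \<circ> \<tau>\<^sub>1)) \<partial>measure_pmf \<mu>)"
    unfolding marg_reflect[OF assms(1,2)]
  proof (rule integral_cong_AE, simp, simp, rule AE_pmfI)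
    fix f assume f: "f \<in> set_pmf \<mu>"
    show "indicator (agree A (k \<circ> \<tau>\<^sub>1)) f *
        measure_pmf.prob (cond_pmf \<mu> (agree X f)) (agree B (k \<circ> \<tau>\<^sub>2)) =
        indicator (agree A (k \<circ> \<tau>\<^sub>1)) f * (marg \<mu> B (k \<circ> \<tau>\<^sub>2) / marg \<mu> X (k \<circ> \<tau>\<^sub>1))"
    proof (cases "f \<in> agree A (k \<circ> \<tau>\<^sub>1)")
      case True
      then have fX: "f \<in> agree X (k \<circ> \<tau>\<^sub>1)"
        using assms by (auto simp: agree_def)
      \<comment> \<open>The gluing maps coincide on \<open>X\<close>, so agreement on
        \<open>B\<close> already implies the conditioning event, and the intersection of the two
        events is the former.\<close>
      moreover have "agree B (k \<circ> \<tau>\<^sub>2) \<subseteq> agree X f"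
        using fX gluing_mapsD(3)[OF G] assms by (fastforce simp: agree_def)
      ultimately have "measure_pmf.prob (cond_pmf \<mu> (agree X f)) (agree B (k \<circ> \<tau>\<^sub>2))
          = marg \<mu> B (k \<circ> \<tau>\<^sub>2) / marg \<mu> X (k \<circ> \<tau>\<^sub>1)"
        unfolding measure_cond_pmf[OF support_inter_agree[OF f]]
        by (simp add: marg_def agree_cong Int_absorb1)
      then show ?thesis by simp
    qed simp
  qed
  then show ?thesis by (simp add: marg_def)
qed

lemma cond_indep_reflect:
  assumes "A \<subseteq> V" "B \<subseteq> L" "X \<subseteq> A" "X \<subseteq> B"
  shows "cond_indep \<mu>' (\<tau>\<^sub>1 ` A) (\<tau>\<^sub>2 ` B)"
  unfolding cond_indep_def
proof
  fix k
  have "\<tau>\<^sub>1 ` X \<subseteq> \<tau>\<^sub>2 ` B"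
    using gluing_mapsD(3)[OF G] assms by force
  then have int: "\<tau>\<^sub>1 ` A \<inter> \<tau>\<^sub>2 ` B = \<tau>\<^sub>1 ` X"
    using gluing_mapsD(4)[OF G] assms by blast
  have X: "marg \<mu>' (\<tau>\<^sub>1 ` X) k = marg \<mu> X (k \<circ> \<tau>\<^sub>1)"
    using marg_reflect_fst[of X k] assms by auto
  \<comment> \<open>If the marginal on \<open>X\<close> vanishes, the quotient in
    \<open>marg_reflect_Un\<close> is a division by zero; monotonicity makes both sides 0 in that
    case.\<close>
  have "marg \<mu> A (k \<circ> \<tau>\<^sub>1) = 0" if "marg \<mu> X (k \<circ> \<tau>\<^sub>1) = 0"
    using marg_antimono[OF assms(3), of \<mu> "k \<circ> \<tau>\<^sub>1"] marg_nonneg[of \<mu> A "k \<circ> \<tau>\<^sub>1"] that by linarith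
  then show "marg \<mu>' (\<tau>\<^sub>1 ` A \<union> \<tau>\<^sub>2 ` B) k * marg \<mu>' (\<tau>\<^sub>1 ` A \<inter> \<tau>\<^sub>2 ` B) k
      = marg \<mu>' (\<tau>\<^sub>1 ` A) k * marg \<mu>' (\<tau>\<^sub>2 ` B) k"
    unfolding int X marg_reflect_Un[OF assms] marg_reflect_fst[OF assms(1)]
      marg_reflect_snd[OF assms(2)]
    by (cases "marg \<mu> X (k \<circ> \<tau>\<^sub>1) = 0") auto
qed

lemma cond_indep_reflect_fst:
  assumes "A \<subseteq> V" "B \<subseteq> V" "cond_indep \<mu> A B"
  shows "cond_indep \<mu>' (\<tau>\<^sub>1 ` A) (\<tau>\<^sub>1 ` B)"
proof -
  have "\<tau>\<^sub>1 ` A \<inter> \<tau>\<^sub>1 ` B = \<tau>\<^sub>1 ` (A \<inter> B)"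
    using inj_on_image_Int[OF gluing_mapsD(1)[OF G] assms(1,2)] by simp
  moreover have "A \<union> B \<subseteq> V" "A \<inter> B \<subseteq> V" using assms by auto
  ultimately show ?thesis
    using assms by (simp add: cond_indep_def marg_reflect_fst flip: image_Un)
qed

lemma cond_indep_reflect_snd:
  assumes "A \<subseteq> L" "B \<subseteq> L" "cond_indep \<mu> A B"
  shows "cond_indep \<mu>' (\<tau>\<^sub>2 ` A) (\<tau>\<^sub>2 ` B)"
proof -
  have "\<tau>\<^sub>2 ` A \<inter> \<tau>\<^sub>2 ` B = \<tau>\<^sub>2 ` (A \<inter> B)"
    using inj_on_image_Int[OF gluing_mapsD(2)[OF G] assms(1,2)] by simp
  moreover have "A \<union> B \<subseteq> L" "A \<inter> B \<subseteq> L" using assms by auto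
  ultimately show ?thesis
    using assms by (simp add: cond_indep_def marg_reflect_snd flip: image_Un)
qed

lemma finite_support_reflect:
  assumes "finite (set_pmf \<mu>)"
  shows "finite (set_pmf \<mu>')"
  using assms by (auto simp: reflect_pmf_def set_cond_pmf[OF support_inter_agree])

end

lemma cond_indep_commute: "cond_indep \<mu> A B \<longleftrightarrow> cond_indep \<mu> B A"
  by (simp add: cond_indep_def Un_commute Int_commute mult.commute)

section \<open>Reflection complexes carry an edge-uniform distribution\<close>

lemma reflect_simps:
  "verts (reflect M L X \<tau>\<^sub>1 \<tau>\<^sub>2) = \<tau>\<^sub>1 ` verts M \<union> \<tau>\<^sub>2 ` L"
  "edges (reflect M L X \<tau>\<^sub>1 \<tau>\<^sub>2) = {\<tau>\<^sub>1 ` K |K. K \<in> edges M} \<union>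
     {\<tau>\<^sub>2 ` K |K. K \<in> edges M \<and> K \<subseteq> L} \<union>
     {\<tau>\<^sub>1 ` K\<^sub>1 \<union> \<tau>\<^sub>2 ` K\<^sub>2 |K\<^sub>1 K\<^sub>2. (K\<^sub>1, K\<^sub>2) \<in> reflected_pairs M L X}"
  by (simp_all add: reflect_def sub_bhyp_def Let_def)

lemma reflected_pairs_iff:
  "(K\<^sub>1, K\<^sub>2) \<in> reflected_pairs M L X \<longleftrightarrow>
     K\<^sub>1 \<in> edges M \<and> K\<^sub>2 \<in> edges M \<and> K\<^sub>2 \<subseteq> L \<and> X \<subseteq> K\<^sub>1 \<and> X \<subseteq> K\<^sub>2"
  by (auto simp: reflected_pairs_def sub_bhyp_def)

lemma edges_reflect_cases:
  assumes "e \<in> edges (reflect M L X \<tau>\<^sub>1 \<tau>\<^sub>2)"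
  obtains (fst) K where "K \<in> edges M" "e = \<tau>\<^sub>1 ` K"
    | (snd) K where "K \<in> edges M" "K \<subseteq> L" "e = \<tau>\<^sub>2 ` K"
    | (both) K\<^sub>1 K\<^sub>2 where "K\<^sub>1 \<in> edges M" "K\<^sub>2 \<in> edges M" "K\<^sub>2 \<subseteq> L" "e = \<tau>\<^sub>1 ` K\<^sub>1 \<union> \<tau>\<^sub>2 ` K\<^sub>2"
  using assms unfolding reflect_simps by (auto simp: reflected_pairs_iff)

lemma brel_reflect_cases:
  assumes "(S, T) \<in> brel (reflect M L X \<tau>\<^sub>1 \<tau>\<^sub>2)"
  obtains (fst) A B where "(A, B) \<in> brel M" "S = \<tau>\<^sub>1 ` A" "T = \<tau>\<^sub>1 ` B"
    | (snd) A B where "(A, B) \<in> brel M" "A \<subseteq> L" "B \<subseteq> L" "S = \<tau>\<^sub>2 ` A" "T = \<tau>\<^sub>2 ` B"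
    | (cross) A B where "(A, B) \<in> reflected_pairs M L X" "S = \<tau>\<^sub>1 ` A" "T = \<tau>\<^sub>2 ` B"
    | (cross') A B where "(A, B) \<in> reflected_pairs M L X" "S = \<tau>\<^sub>2 ` B" "T = \<tau>\<^sub>1 ` A"
  using assms unfolding reflect_def sub_bhyp_def Let_def by auto

lemma reflection_complex_subsets:
  assumes "reflection_complex M"
  shows "finite (verts M)" "e \<in> edges M \<Longrightarrow> e \<subseteq> verts M"
    "(A, B) \<in> brel M \<Longrightarrow> A \<subseteq> verts M \<and> B \<subseteq> verts M"
  using reflection_complex_b_hypergraph[OF assms] by (auto simp: b_hypergraph_def)

text \<open>The \<open>2\<close>-edges must be found inside every edge \<open>K\<close>, since a reflection copies only the part of
  the complex contained in an edge.\<close>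

lemma reflection_complex_two_edges:
  assumes "reflection_complex M"
  shows "(\<forall>v\<in>verts M. \<exists>K\<in>edges M. v \<in> K) \<and>
    (\<forall>K\<in>edges M. 2 \<le> card K \<and> (\<forall>v\<in>K. \<exists>e\<in>edges M. card e = 2 \<and> v \<in> e \<and> e \<subseteq> K))"
  using assms
proof (induction rule: reflection_complex.induct)
  case (single_edge a b)
  then show ?case by auto
next
  case (reflect M L X \<tau>\<^sub>1 \<tau>\<^sub>2)
  let ?M = "reflect M L X \<tau>\<^sub>1 \<tau>\<^sub>2"
  note sub = reflection_complex_subsets[OF reflect.hyps(1)]
  note inj = gluing_mapsD(1,2)[OF reflect.hyps(4)]
  have im1: "\<tau>\<^sub>1 ` K \<in> edges ?M \<and> card (\<tau>\<^sub>1 ` K) = card K" if "K \<in> edges M" for K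
    using that sub(2)[OF that] inj(1)
    by (auto simp: reflect_simps intro: card_image inj_on_subset)
  have im2: "\<tau>\<^sub>2 ` K \<in> edges ?M \<and> card (\<tau>\<^sub>2 ` K) = card K" if "K \<in> edges M" "K \<subseteq> L" for K
    using that inj(2)
    by (auto simp: reflect_simps intro: card_image inj_on_subset)
  have fst_e: "\<exists>e\<in>edges ?M. card e = 2 \<and> v \<in> e \<and> e \<subseteq> \<tau>\<^sub>1 ` K"
    if K: "K \<in> edges M" "v \<in> \<tau>\<^sub>1 ` K" for K v
  proof -
    obtain x where x: "x \<in> K" "v = \<tau>\<^sub>1 x" using K by blast
    then obtain e where "e \<in> edges M" "card e = 2" "x \<in> e" "e \<subseteq> K"
      using reflect.IH K by blast
    then show ?thesis using im1 x by (intro bexI[of _ "\<tau>\<^sub>1 ` e"]) auto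
  qed
  have snd_e: "\<exists>e\<in>edges ?M. card e = 2 \<and> v \<in> e \<and> e \<subseteq> \<tau>\<^sub>2 ` K"
    if K: "K \<in> edges M" "K \<subseteq> L" "v \<in> \<tau>\<^sub>2 ` K" for K v
  proof -
    obtain x where x: "x \<in> K" "v = \<tau>\<^sub>2 x" using K by blast
    then obtain e where "e \<in> edges M" "card e = 2" "x \<in> e" "e \<subseteq> K"
      using reflect.IH K by blast
    then show ?thesis using im2[of e] x K by (intro bexI[of _ "\<tau>\<^sub>2 ` e"]) auto
  qed
  have "\<exists>K\<in>edges ?M. v \<in> K" if v: "v \<in> verts ?M" for v
  proof (cases "v \<in> \<tau>\<^sub>1 ` verts M")
    case True
    then obtain x where "x \<in> verts M" "v = \<tau>\<^sub>1 x" by blast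
    moreover then obtain K where "K \<in> edges M" "x \<in> K"
      using reflect.IH by blast
    ultimately show ?thesis using im1[of K] by (intro bexI[of _ "\<tau>\<^sub>1 ` K"]) auto
  next
    case False
    then have "v \<in> \<tau>\<^sub>2 ` L" using v unfolding reflect_simps by blast
    \<comment> \<open>As \<open>L\<close> is an edge of \<open>M\<close>, its entire second copy is
      an edge of the reflection.\<close>
    then show ?thesis using im2[OF reflect.hyps(2)] by blast
  qed
  moreover have "2 \<le> card K \<and> (\<forall>v\<in>K. \<exists>e\<in>edges ?M. card e = 2 \<and> v \<in> e \<and> e \<subseteq> K)"
    if K: "K \<in> edges ?M" for K
    using K
  proof (cases rule: edges_reflect_cases)
    case (fst K')
    then show ?thesis using reflect.IH im1 fst_e
      by simp
  next
    case (snd K')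
    then show ?thesis using reflect.IH im2 snd_e
      by simp
  next
    case (both K\<^sub>1 K\<^sub>2)
    have "2 \<le> card (\<tau>\<^sub>1 ` K\<^sub>1)" using im1[OF both(1)] reflect.IH both(1) by simp
    moreover have "K\<^sub>1 \<subseteq> verts M" "K\<^sub>2 \<subseteq> verts M"
      using sub(2) both by auto
    then have "finite K" using sub(1) both(4) by (auto intro: finite_subset)
    ultimately have "2 \<le> card K"
      using card_mono[of K "\<tau>\<^sub>1 ` K\<^sub>1"] both(4) by auto
    moreover have "\<exists>e\<in>edges ?M. card e = 2 \<and> v \<in> e \<and> e \<subseteq> K" if "v \<in> K" for v
      using that fst_e[OF both(1), of v] snd_e[OF both(2,3), of v] unfolding both(4) by blast
    ultimately show ?thesis by blast
  qed
  ultimately show ?case by blast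
qed

lemma reflection_complex_edge_card:
  assumes "reflection_complex M" "K \<in> edges M"
  shows "2 \<le> card K"
  using reflection_complex_two_edges[OF assms(1)] assms(2) by blast

lemma reflection_complex_no_isolated:
  assumes "reflection_complex M" "v \<in> verts M"
  obtains e where "e \<in> edges M" "card e = 2" "v \<in> e"
  using reflection_complex_two_edges[OF assms(1)] assms(2) by blast

section \<open>Edge-uniform distributions\<close>

text \<open>For a graph these pairs are the homomorphisms of the single edge, so their number is the
  numerator of the edge density.\<close>

definition dir_edges :: "'b set set \<Rightarrow> ('b \<times> 'b) set" where
  "dir_edges E = {(u, v). {u, v} \<in> E}"

text \<open>Expressing uniformity through the image of \<open>e\<close> requires no orientation of
  \<open>e\<close> and is easily transported along the gluing maps.\<close>

definition edge_uniform :: "'b set set \<Rightarrow> ('a \<Rightarrow> 'b) pmf \<Rightarrow> 'a set \<Rightarrow> bool" where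
  "edge_uniform E \<mu> e \<longleftrightarrow>
     (\<forall>f. marg \<mu> e f = (if f ` e \<in> E then 1 / card (dir_edges E) else 0))"

lemma edge_uniform_pair:
  assumes fin: "finite (dir_edges E)" "dir_edges E \<noteq> {}" and ab: "a \<noteq> b"
  shows "\<exists>\<mu> :: ('a \<Rightarrow> 'b) pmf. finite (set_pmf \<mu>) \<and> edge_uniform E \<mu> {a, b}"
proof -
  \<comment> \<open>All vertices other than \<open>a\<close> receive the second endpoint; only the
    values at \<open>a\<close> and \<open>b\<close> matter.\<close>
  let ?h = "\<lambda>(u, v) x. if x = a then u else v"
  define \<mu> :: "('a \<Rightarrow> 'b) pmf" where "\<mu> = map_pmf ?h (pmf_of_set (dir_edges E))"
  have "edge_uniform E \<mu> {a, b}"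
    unfolding edge_uniform_def
  proof
    fix f :: "'a \<Rightarrow> 'b"
    have "?h -` agree {a, b} f = {(f a, f b)}"
      using ab by (auto simp: agree_def)
    then have "marg \<mu> {a, b} f = card (dir_edges E \<inter> {(f a, f b)}) / card (dir_edges E)"
      using fin by (simp add: marg_def \<mu>_def measure_pmf_of_set)
    then show "marg \<mu> {a, b} f = (if f ` {a, b} \<in> E then 1 / card (dir_edges E) else 0)"
      by (auto simp: dir_edges_def)
  qed
  moreover have "finite (set_pmf \<mu>)"
    using fin by (simp add: \<mu>_def)
  ultimately show ?thesis by blast
qed

text \<open>Induction along the construction, turning each reflection into
  \<open>reflect_pmf\<close>. Old edges and pairs keep their marginals in both copies, and each new
  pair is conditionally independent by the choice of the second map.\<close>

lemma reflection_complex_pmf: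
  fixes M :: "'a bhyp" and E :: "'b set set"
  assumes "reflection_complex M" and E: "finite (dir_edges E)" "dir_edges E \<noteq> {}"
  shows "\<exists>\<mu> :: ('a \<Rightarrow> 'b) pmf. finite (set_pmf \<mu>) \<and>
    (\<forall>e\<in>edges M. card e = 2 \<longrightarrow> edge_uniform E \<mu> e) \<and> (\<forall>(A, B)\<in>brel M. cond_indep \<mu> A B)"
  using assms(1)
proof (induction rule: reflection_complex.induct)
  case (single_edge a b)
  then show ?case using edge_uniform_pair[OF E, of a b] by simp
next
  case (reflect M L X \<tau>\<^sub>1 \<tau>\<^sub>2)
  note sub = reflection_complex_subsets[OF reflect.hyps(1)]
  note inj = gluing_mapsD(1,2)[OF reflect.hyps(4)]
  obtain \<mu> :: "('a \<Rightarrow> 'b) pmf" where fin: "finite (set_pmf \<mu>)"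
    and unif: "\<And>e. e \<in> edges M \<Longrightarrow> card e = 2 \<Longrightarrow> edge_uniform E \<mu> e"
    and ci: "\<And>A B. (A, B) \<in> brel M \<Longrightarrow> cond_indep \<mu> A B"
    using reflect.IH by blast
  interpret gluing "verts M" L X \<tau>\<^sub>1 \<tau>\<^sub>2 \<mu>
    by standard (use reflect.hyps sub(2) in auto)
  have fst: "edge_uniform E \<mu>' (\<tau>\<^sub>1 ` K)" if "K \<in> edges M" "card (\<tau>\<^sub>1 ` K) = 2" for K
  proof -
    have "card K = 2"
      using that sub(2)[OF that(1)] inj(1) by (metis card_image inj_on_subset)
    then show ?thesis
      using unif[OF that(1)] sub(2)[OF that(1)]
      by (simp add: edge_uniform_def marg_reflect_fst image_comp)
  qed
  have snd: "edge_uniform E \<mu>' (\<tau>\<^sub>2 ` K)"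
    if "K \<in> edges M" "K \<subseteq> L" "card (\<tau>\<^sub>2 ` K) = 2" for K
  proof -
    have "card K = 2"
      using that inj(2) by (metis card_image inj_on_subset)
    then show ?thesis
      using unif[OF that(1)] that(2)
      by (simp add: edge_uniform_def marg_reflect_snd image_comp)
  qed
  have "edge_uniform E \<mu>' e" if e: "e \<in> edges (reflect M L X \<tau>\<^sub>1 \<tau>\<^sub>2)" "card e = 2" for e
    using e(1)
  proof (cases rule: edges_reflect_cases)
    case (both K\<^sub>1 K\<^sub>2)
    \<comment> \<open>edges have at least two vertices, so a \<open>2\<close>-edge of this form is just \<open>\<tau>\<^sub>1 ` K\<^sub>1\<close>\<close>
    have "card (\<tau>\<^sub>1 ` K\<^sub>1) = card K\<^sub>1"
      using sub(2)[OF both(1)] inj(1) by (metis card_image inj_on_subset)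
    then have "card e \<le> card (\<tau>\<^sub>1 ` K\<^sub>1)"
      using reflection_complex_edge_card[OF reflect.hyps(1) both(1)] e(2) by simp
    moreover have "finite e"
      using e(2) by (metis card.infinite zero_neq_numeral)
    ultimately have "e = \<tau>\<^sub>1 ` K\<^sub>1"
      using both(4) card_seteq[of e "\<tau>\<^sub>1 ` K\<^sub>1"] by auto
    then show ?thesis using fst[OF both(1)] e(2) by simp
  qed (use fst snd e(2) in auto)
  moreover have "cond_indep \<mu>' S T" if "(S, T) \<in> brel (reflect M L X \<tau>\<^sub>1 \<tau>\<^sub>2)" for S T
    using that
  proof (cases rule: brel_reflect_cases)
    case (fst A B)
    then show ?thesis using cond_indep_reflect_fst[of A B] ci sub(3) by auto
  next
    case (snd A B)
    then show ?thesis using cond_indep_reflect_snd[of A B] ci by auto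
  next
    case (cross A B)
    then show ?thesis using cond_indep_reflect[of A B] sub(2)[of A] by (auto simp: reflected_pairs_iff)
  next
    case (cross' A B)
    then have "cond_indep \<mu>' T S"
      using cond_indep_reflect[of A B] sub(2)[of A] by (auto simp: reflected_pairs_iff)
    then show ?thesis by (simp add: cond_indep_commute)
  qed
  ultimately show ?case
    using finite_support_reflect[OF fin] by blast
qed

section \<open>Supermodular functions and thickness\<close>

lemma sum_one_vec:
  assumes "finite \<A>" "S \<in> \<A>"
  shows "(\<Sum>T\<in>\<A>. one_vec S T * D T) = D S"
proof -
  have "(\<Sum>T\<in>\<A>. one_vec S T * D T) = (\<Sum>T\<in>\<A>. if T = S then D T else 0)"
    by (rule sum.cong) (auto simp: one_vec_def)
  then show ?thesis using assms by simp
qed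

text \<open>Linearity of the pairing through which a set function \<open>D\<close> acts on vectors
  indexed by subsets.\<close>

lemma sum_combination:
  fixes c :: "'i \<Rightarrow> real"
  shows "(\<Sum>T\<in>\<A>. (\<Sum>i\<in>I. c i * x i T) * D T) = (\<Sum>i\<in>I. c i * (\<Sum>T\<in>\<A>. x i T * D T))"
proof -
  have "(\<Sum>T\<in>\<A>. (\<Sum>i\<in>I. c i * x i T) * D T) = (\<Sum>T\<in>\<A>. \<Sum>i\<in>I. c i * (x i T * D T))"
    by (simp add: sum_distrib_right mult.assoc)
  also have "\<dots> = (\<Sum>i\<in>I. \<Sum>T\<in>\<A>. c i * (x i T * D T))"
    by (rule sum.swap)
  finally show ?thesis by (simp add: sum_distrib_left)
qed

text \<open>The pairing turns \<open>t_vec\<close> into the modularity defect of \<open>D\<close>: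
  zero on modular pairs, nonnegative for supermodular \<open>D\<close>.\<close>

lemma sum_t_vec:
  assumes "finite V" "A \<subseteq> V" "B \<subseteq> V"
  shows "(\<Sum>T\<in>Pow V. t_vec A B T * D T) = D (A \<union> B) - D A - D B + D (A \<inter> B)"
proof -
  have "A \<union> B \<in> Pow V" "A \<inter> B \<in> Pow V" "A \<in> Pow V" "B \<in> Pow V" using assms by auto
  note sum_one_vec[OF _ this(1), of D] sum_one_vec[OF _ this(2), of D]
    sum_one_vec[OF _ this(3), of D] sum_one_vec[OF _ this(4), of D]
  then show ?thesis
    using assms by (simp add: t_vec_def algebra_simps sum.distrib sum_subtractf)
qed

lemma W_space_sum:
  assumes w: "w \<in> W_space R" and V: "finite V" "R \<subseteq> Pow V \<times> Pow V"
    and mod: "\<And>A B. (A, B) \<in> R \<Longrightarrow> D (A \<union> B) + D (A \<inter> B) = D A + (D B :: real)"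
  shows "(\<Sum>T\<in>Pow V. w T * D T) = 0"
proof -
  obtain c where "w = (\<lambda>T. \<Sum>(A, B)\<in>R. c (A, B) * t_vec A B T)"
    using w unfolding W_space_def by blast
  then have w_eq: "w = (\<lambda>T. \<Sum>p\<in>R. c p * t_vec (fst p) (snd p) T)"
    by (simp add: split_def)
  have "(\<Sum>T\<in>Pow V. w T * D T)
      = (\<Sum>p\<in>R. c p * (\<Sum>T\<in>Pow V. t_vec (fst p) (snd p) T * D T))"
    unfolding w_eq by (rule sum_combination)
  also have "\<dots> = 0"
  proof (rule sum.neutral, rule ballI)
    fix p assume p: "p \<in> R"
    obtain A B where AB: "p = (A, B)" by (cases p)
    have "A \<subseteq> V" "B \<subseteq> V" using p AB V by auto
    then show "c p * (\<Sum>T\<in>Pow V. t_vec (fst p) (snd p) T * D T) = 0"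
      using mod[of A B] p V by (simp add: AB sum_t_vec)
  qed
  finally show ?thesis .
qed

text \<open>The coefficient \<open>r\<close> may have any sign, but it meets \<open>D {}\<close> =
  0. The other generators pair nonnegatively by supermodularity and nonnegativity of
  \<open>D\<close>.\<close>

lemma Q_cone_sum:
  assumes q: "q \<in> Q_cone V" and V: "finite V"
    and D: "D {} = (0 :: real)" "\<And>A. A \<subseteq> V \<Longrightarrow> 0 \<le> D A"
      "\<And>A B. A \<subseteq> V \<Longrightarrow> B \<subseteq> V \<Longrightarrow> D A + D B \<le> D (A \<union> B) + D (A \<inter> B)"
  shows "0 \<le> (\<Sum>T\<in>Pow V. q T * D T)"
proof -
  obtain r c d where c: "\<forall>A\<in>Pow V. \<forall>B\<in>Pow V. (0 :: real) \<le> c (A, B)"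
    and d: "\<forall>A\<in>Pow V. (0 :: real) \<le> d A"
    and "q = (\<lambda>T. r * one_vec {} T + (\<Sum>(A, B)\<in>Pow V \<times> Pow V. c (A, B) * t_vec A B T)
            + (\<Sum>A\<in>Pow V. d A * one_vec A T))"
    using q unfolding Q_cone_def by blast
  then have q_eq: "q = (\<lambda>T. r * one_vec {} T + (\<Sum>p\<in>Pow V \<times> Pow V. c p * t_vec (fst p) (snd p) T)
            + (\<Sum>A\<in>Pow V. d A * one_vec A T))"
    by (simp add: split_def)
  have "(\<Sum>T\<in>Pow V. q T * D T) = r * (\<Sum>T\<in>Pow V. one_vec {} T * D T)
      + (\<Sum>p\<in>Pow V \<times> Pow V. c p * (\<Sum>T\<in>Pow V. t_vec (fst p) (snd p) T * D T))
      + (\<Sum>A\<in>Pow V. d A * (\<Sum>T\<in>Pow V. one_vec A T * D T))"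
    unfolding q_eq distrib_right sum.distrib sum_combination
    by (simp add: sum_distrib_left mult.assoc)
  also have "\<dots> = (\<Sum>p\<in>Pow V \<times> Pow V. c p * (\<Sum>T\<in>Pow V. t_vec (fst p) (snd p) T * D T))
      + (\<Sum>A\<in>Pow V. d A * D A)"
    using V D(1) by (simp add: sum_one_vec)
  also have "\<dots> \<ge> 0"
  proof (intro add_nonneg_nonneg sum_nonneg)
    fix p assume "p \<in> Pow V \<times> Pow V"
    then obtain A B where AB: "p = (A, B)" "A \<subseteq> V" "B \<subseteq> V" by auto
    show "0 \<le> c p * (\<Sum>T\<in>Pow V. t_vec (fst p) (snd p) T * D T)"
      unfolding AB(1) fst_conv snd_conv sum_t_vec[OF V AB(2,3)]
      using c AB(2,3) D(3)[OF AB(2,3)] by (intro mult_nonneg_nonneg) auto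
  qed (use d D(2) in auto)
  finally show ?thesis .
qed

lemma h_vec_sum:
  assumes V: "finite V" and H: "gedges H \<subseteq> Pow V"
  shows "(\<Sum>T\<in>Pow V. h_vec H V T * D T) =
    - D V + (\<Sum>e\<in>gedges H. D e) - (\<Sum>v\<in>V. (real (degree H v) - 1) * D {v})"
proof -
  have F: "gedges (induced_subgraph H V) = gedges H"
    using H by (auto simp: induced_subgraph_def)
  then have deg: "degree (induced_subgraph H V) v = degree H v" for v
    by (simp add: degree_def)
  \<comment> \<open>The coefficient 1 in the edge sum puts it into the form required by
    \<open>sum_combination\<close>.\<close>
  have "(\<Sum>T\<in>Pow V. h_vec H V T * D T) = - (\<Sum>T\<in>Pow V. one_vec V T * D T)
      + (\<Sum>T\<in>Pow V. (\<Sum>e\<in>gedges H. 1 * one_vec e T) * D T)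
      - (\<Sum>T\<in>Pow V. (\<Sum>v\<in>V. (real (degree H v) - 1) * one_vec {v} T) * D T)"
    by (simp add: h_vec_def Let_def F deg distrib_right left_diff_distrib sum.distrib
        sum_subtractf sum_negf)
  also have "\<dots> = - D V + (\<Sum>e\<in>gedges H. 1 * D e)
      - (\<Sum>v\<in>V. (real (degree H v) - 1) * D {v})"
  proof -
    have "(\<Sum>e\<in>gedges H. 1 * (\<Sum>T\<in>Pow V. one_vec e T * D T)) = (\<Sum>e\<in>gedges H. 1 * D e)"
      using V H by (intro sum.cong refl) (simp add: sum_one_vec subset_iff)
    moreover have "(\<Sum>v\<in>V. (real (degree H v) - 1) * (\<Sum>T\<in>Pow V. one_vec {v} T * D T))
        = (\<Sum>v\<in>V. (real (degree H v) - 1) * D {v})"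
      using V by (intro sum.cong refl) (simp add: sum_one_vec)
    ultimately show ?thesis
      using V unfolding sum_combination by (simp add: sum_one_vec)
  qed
  finally show ?thesis by simp
qed

text \<open>Pair both sides of the thickness identity with \<open>D\<close>: the part in
  \<open>W_space\<close> vanishes and the part in \<open>Q_cone\<close> is nonnegative.\<close>

lemma thick_supermodular:
  assumes "thick M" "b_hypergraph M"
    and D: "D {} = (0 :: real)" "\<And>A. A \<subseteq> verts M \<Longrightarrow> 0 \<le> D A"
      "\<And>A B. A \<subseteq> verts M \<Longrightarrow> B \<subseteq> verts M \<Longrightarrow> D A + D B \<le> D (A \<union> B) + D (A \<inter> B)"
      "\<And>A B. (A, B) \<in> brel M \<Longrightarrow> D (A \<union> B) + D (A \<inter> B) = D A + D B"
  shows "D (verts M) \<le> (\<Sum>e\<in>gedges (frame M). D e)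
     - (\<Sum>v\<in>verts M. (real (degree (frame M) v) - 1) * D {v})"
proof -
  let ?V = "verts M"
  have V: "finite ?V" "gedges (frame M) \<subseteq> Pow ?V" "brel M \<subseteq> Pow ?V \<times> Pow ?V"
    using assms(2) by (auto simp: b_hypergraph_def frame_def)
  obtain w q where w: "w \<in> W_space (brel M)" and q: "q \<in> Q_cone ?V"
    and eq: "h_vec (frame M) ?V = (\<lambda>T. w T + q T)"
    using assms(1) unfolding thick_def by blast
  have "(\<Sum>T\<in>Pow ?V. h_vec (frame M) ?V T * D T)
      = (\<Sum>T\<in>Pow ?V. w T * D T) + (\<Sum>T\<in>Pow ?V. q T * D T)"
    by (simp add: eq distrib_right sum.distrib)
  also have "\<dots> \<ge> 0"
    using W_space_sum[where D = D, OF w V(1,3) D(4)] Q_cone_sum[where D = D, OF q V(1) D(1-3)]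
    by simp
  finally show ?thesis
    using h_vec_sum[OF V(1,2), of D] by linarith
qed

section \<open>Homomorphism densities\<close>

lemma hom_density_eq:
  assumes "finite (gverts H)" "finite (gverts G)" "gverts G \<noteq> {}"
  shows "hom_density H G =
    card {f \<in> gverts H \<rightarrow>\<^sub>E gverts G. \<forall>e\<in>gedges H. f ` e \<in> gedges G}
      / card (gverts G) ^ card (gverts H)"
proof -
  let ?F = "gverts H \<rightarrow>\<^sub>E gverts G"
  have "?F \<noteq> {}" "finite ?F"
    using assms by (auto simp: PiE_eq_empty_iff intro: finite_PiE)
  then have "hom_density H G
      = card (?F \<inter> {f. \<forall>e\<in>gedges H. f ` e \<in> gedges G}) / card ?F"
    unfolding hom_density_def by (rule measure_pmf_of_set)
  also have "?F \<inter> {f. \<forall>e\<in>gedges H. f ` e \<in> gedges G}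
      = {f \<in> ?F. \<forall>e\<in>gedges H. f ` e \<in> gedges G}"
    by auto
  also have "card ?F = card (gverts G) ^ card (gverts H)"
    using assms by (simp add: card_funcsetE)
  finally show ?thesis by simp
qed

lemma hom_density_edge_graph:
  assumes G: "finite_graph G" "gverts G \<noteq> {}"
  shows "hom_density edge_graph G = card (dir_edges (gedges G)) / (card (gverts G))\<^sup>2"
proof -
  let ?F = "{f \<in> {1, 2 :: nat} \<rightarrow>\<^sub>E gverts G. f ` {1, 2} \<in> gedges G}"
  have "bij_betw (\<lambda>f. (f 1, f 2)) ?F (dir_edges (gedges G))"
  \<comment> \<open>The inverse is \<open>undefined\<close> off {1, 2} because the maps counted are
    extensional.\<close>
  proof (rule bij_betwI[where g = "\<lambda>(u, v) x. if x = 1 then u else if x = 2 then v else undefined"])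
    show "(\<lambda>(u, v) x. if x = 1 then u else if x = 2 then v else undefined)
        \<in> dir_edges (gedges G) \<rightarrow> ?F"
    proof
      fix p assume p: "p \<in> dir_edges (gedges G)"
      then have "fst p \<in> gverts G" "snd p \<in> gverts G"
        using G by (auto simp: dir_edges_def finite_graph_def)
      then show "(case p of (u, v) \<Rightarrow> \<lambda>x. if x = 1 then u else if x = 2 then v else undefined) \<in> ?F"
        using p by (auto simp: dir_edges_def PiE_def extensional_def)
    qed
  qed (auto simp: dir_edges_def fun_eq_iff PiE_def extensional_def)
  then have "card ?F = card (dir_edges (gedges G))"
    by (rule bij_betw_same_card)
  then show ?thesis
    using hom_density_eq[of edge_graph G] G
    by (simp add: edge_graph_def finite_graph_def power2_eq_square)
qed

section \<open>From thickness to the density inequality\<close>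

theorem theorem6p2:
  fixes H :: "'a graph" and G :: "'b graph"
  assumes "thick_graph H"
    and "finite_graph G" and "gverts G \<noteq> {}"
  shows "hom_density H G \<ge> hom_density edge_graph G ^ card (gedges H)"
proof -
  obtain M where M: "reflection_complex M" "thick M" and H: "H = frame M"
    using assms(1) unfolding thick_graph_def by blast
  note sub = reflection_complex_subsets[OF M(1)]
  define V where "V = verts M"
  define n where "n = real (card (gverts G))"
  define m where "m = real (card (dir_edges (gedges G)))"
  define Homs where "Homs = {f \<in> V \<rightarrow>\<^sub>E gverts G. \<forall>e\<in>gedges H. f ` e \<in> gedges G}"
  have finV: "finite V" and gV: "gverts H = V" and finG: "finite (gverts G)"
    using sub(1) assms(2) by (auto simp: V_def H frame_def finite_graph_def)
  have gE: "e \<in> gedges H \<longleftrightarrow> e \<in> edges M \<and> card e = 2" for e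
    by (auto simp: H frame_def)
  have gsub: "gedges H \<subseteq> Pow V"
    using sub(2) gE unfolding V_def by blast
  then have finE: "finite (gedges H)"
    using finV by (auto intro: finite_subset)
  have n: "n > 0" using finG assms(3) by (simp add: n_def card_gt_0_iff)
  have tH: "hom_density H G = card Homs / n ^ card V"
    using hom_density_eq[of H G] finV finG assms(3) by (simp add: gV Homs_def n_def)
  have te: "hom_density edge_graph G = m / n\<^sup>2"
    using hom_density_edge_graph[OF assms(2,3)] by (simp add: m_def n_def)
  have finHoms: "finite Homs"
    using finV finG unfolding Homs_def by (intro finite_subset[OF _ finite_PiE]) auto
  have exE: "\<exists>e\<in>gedges H. v \<in> e" if "v \<in> V" for v
    using reflection_complex_no_isolated[OF M(1), of v] that gE unfolding V_def by blast
  have "V \<noteq> {}"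
    using M(1) unfolding V_def by (induction rule: reflection_complex.induct) (auto simp: reflect_simps)
  then have "gedges H \<noteq> {}" using exE by auto
  \<comment> \<open>The exponent must be positive for the case of an edgeless \<open>G\<close>,
    since 0 to the power 0 is 1.\<close>
  then have cardE: "card (gedges H) > 0" using finE by (simp add: card_gt_0_iff)
  show ?thesis
  proof (cases "dir_edges (gedges G) = {}")
    case True
    then have "hom_density edge_graph G ^ card (gedges H) = 0"
      using cardE by (simp add: te m_def)
    also have "\<dots> \<le> hom_density H G"
      by (simp add: hom_density_def)
    finally show ?thesis .
  next
    case False
    have "dir_edges (gedges G) \<subseteq> gverts G \<times> gverts G"
      using assms(2) by (auto simp: dir_edges_def finite_graph_def)
    then have finD: "finite (dir_edges (gedges G))"
      using finG by (meson finite_SigmaI finite_subset)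
    then have m: "m > 0" using False by (simp add: m_def card_gt_0_iff)
    obtain \<mu> :: "('a \<Rightarrow> 'b) pmf" where fin: "finite (set_pmf \<mu>)"
      and unif: "\<And>e. e \<in> gedges H \<Longrightarrow> edge_uniform (gedges G) \<mu> e"
      and ci: "\<And>A B. (A, B) \<in> brel M \<Longrightarrow> cond_indep \<mu> A B"
      using reflection_complex_pmf[OF M(1) finD False] unfolding gE by blast
    \<comment> \<open>Marginals are positive on the support, which excludes the zero branch of
      \<open>edge_uniform\<close>.\<close>
    have edge: "f ` e \<in> gedges G \<and> marg \<mu> e f = 1 / m" if "f \<in> set_pmf \<mu>" "e \<in> gedges H" for f e
      using marg_pos[OF that(1), of e] unif[OF that(2)]
      by (auto simp: edge_uniform_def m_def split: if_splits)
    have range: "f v \<in> gverts G" if f: "f \<in> set_pmf \<mu>" and v: "v \<in> V" for f v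
    proof -
      obtain e where e: "e \<in> gedges H" "v \<in> e" using exE[OF v] by blast
      then have "f ` e \<subseteq> gverts G"
        using edge[OF f e(1)] assms(2) by (simp add: finite_graph_def)
      then show ?thesis using e(2) by blast
    qed
    \<comment> \<open>the divergence of the marginal on \<open>S\<close> from the uniform distribution\<close>
    define D where "D S = card S * ln n - ent \<mu> S" for S
    have "0 \<le> D S" if S: "S \<subseteq> V" for S
    proof -
      have finS: "finite S" using S finV by (rule finite_subset)
      have "ent \<mu> S \<le> ln (card (S \<rightarrow>\<^sub>E gverts G))"
        using fin finS finG range S by (intro ent_le_ln_card finite_PiE) auto
      also have "\<dots> = card S * ln n"
        using finS n by (simp add: card_funcsetE n_def ln_realpow)
      finally show ?thesis by (simp add: D_def)
    qed
    note D_nonneg = this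
    have card_mod: "real (card (A \<union> B)) + real (card (A \<inter> B)) = real (card A) + real (card B)"
      if "A \<subseteq> V" "B \<subseteq> V" for A B
      using card_Un_Int[of A B] that finV by (metis finite_subset of_nat_add)
    \<comment> \<open>The cardinality term is modular, so submodularity of entropy becomes
      supermodularity of \<open>D\<close>.\<close>
    have D_super: "D A + D B \<le> D (A \<union> B) + D (A \<inter> B)" if "A \<subseteq> V" "B \<subseteq> V" for A B
      using ent_submodular[OF fin, of A B] arg_cong[OF card_mod[OF that], of "\<lambda>x. x * ln n"]
      by (simp add: D_def distrib_right)
    have D_mod: "D (A \<union> B) + D (A \<inter> B) = D A + D B" if "(A, B) \<in> brel M" for A B
      using cond_indep_ent[OF ci[OF that]] sub(3)[OF that]
        arg_cong[OF card_mod[of A B], of "\<lambda>x. x * ln n"]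
      by (simp add: D_def distrib_right V_def)
    \<comment> \<open>The marginal on \<open>e\<close> is constantly 1 / \<open>m\<close> on the
      support, so its entropy is ln \<open>m\<close>.\<close>
    have D_edge: "D e = - ln (m / n\<^sup>2)" if e: "e \<in> gedges H" for e
    proof -
      have "ent \<mu> e = (\<Sum>f\<in>set_pmf \<mu>. pmf \<mu> f * ln m)"
        unfolding ent_def using edge[OF _ e] m by (intro sum.cong) (auto simp: ln_div)
      also have "\<dots> = ln m"
        using fin by (simp add: sum_pmf_eq_1 flip: sum_distrib_right)
      finally show ?thesis
        using e m n by (simp add: D_def gE ln_div ln_realpow)
    qed
    have "D V \<le> (\<Sum>e\<in>gedges H. D e) - (\<Sum>v\<in>V. (real (degree H v) - 1) * D {v})"
      unfolding V_def H
    proof (rule thick_supermodular[OF M(2) reflection_complex_b_hypergraph[OF M(1)]])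
      show "D {} = 0" by (simp add: D_def)
    qed (use D_nonneg D_super D_mod in \<open>auto simp: V_def\<close>)
    \<comment> \<open>Every degree is at least 1, so the vertex terms have nonnegative coefficients
      and may be dropped.\<close>
    also have "\<dots> \<le> (\<Sum>e\<in>gedges H. D e)"
    proof -
      have "1 \<le> degree H v" if "v \<in> V" for v
        using exE[OF that] finE by (auto simp: degree_def Suc_le_eq card_gt_0_iff)
      then have "0 \<le> (\<Sum>v\<in>V. (real (degree H v) - 1) * D {v})"
        using D_nonneg by (intro sum_nonneg mult_nonneg_nonneg) auto
      then show ?thesis by simp
    qed
    also have "\<dots> = - (card (gedges H) * ln (m / n\<^sup>2))"
      using D_edge by simp
    finally have DV: "card (gedges H) * ln (m / n\<^sup>2) \<le> - D V" by simp
    \<comment> \<open>Samples are total maps, whereas \<open>Homs\<close> contains extensional ones,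
      hence the restriction to \<open>V\<close>.\<close>
    have sub_Homs: "(\<lambda>f. restrict f V) ` set_pmf \<mu> \<subseteq> Homs"
    proof
      fix h assume "h \<in> (\<lambda>f. restrict f V) ` set_pmf \<mu>"
      then obtain f where f: "f \<in> set_pmf \<mu>" "h = restrict f V" by blast
      have "restrict f V ` e = f ` e" if "e \<in> gedges H" for e
        using gsub that by (intro image_cong) auto
      then show "h \<in> Homs"
        using f edge[OF f(1)] range[OF f(1)] by (auto simp: Homs_def)
    qed
    \<comment> \<open>At least one homomorphism exists, so the logarithm of the density below is a
      genuine one.\<close>
    then have "Homs \<noteq> {}" using set_pmf_not_empty[of \<mu>] by blast
    then have hom_pos: "real (card Homs) > 0" using finHoms by (simp add: card_gt_0_iff)
    have "- D V \<le> ln (card Homs) - card V * ln n"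
      using ent_le_ln_card[OF fin finHoms sub_Homs] by (simp add: D_def)
    also have "\<dots> = ln (hom_density H G)"
      using hom_pos n by (simp add: tH ln_div ln_realpow)
    finally have "ln ((m / n\<^sup>2) ^ card (gedges H)) \<le> ln (hom_density H G)"
      using DV m n by (simp add: ln_realpow)
    then show ?thesis
      using m n hom_pos by (simp add: te tH)
  qed
qed

end
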